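(* For $t,k,r\in\mathbb{N}$, we have $$q^{-\frac{rt(t+1)}{2}}\,\mathcal{U}_{t,k,r}(a;q)=\prod_{n\ge1}\frac{1}{(1-q^{nr})(1+aq^n+q^{2n})^k}+O(q^{t+1}),$$ where $$\mathcal{U}_{t,k,r}(a;q)=\sum_{1\le n_1<n_2<\cdots<n_t}\frac{q^{r(n_1+n_2+\cdots+n_t)}}{(1+aq^{n_1}+q^{2n_1})^k\cdots(1+aq^{n_t}+q^{2n_t})^k}.$$
   Context: $\mathbb{N}=\{1,2,3,\ldots\}$. All expressions are regarded as formal power series in $q$, with $a$ a complex number (or an indeterminate). $O(q^{t+1})$ denotes a formal power series in $q$ divisible by $q^{t+1}$, i.e. the two sides agree in all coefficients of $q^0,\ldots,q^t$. *)

theory Defs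
  imports "HOL-Complex_Analysis.Laurent_Convergence"
begin

unbundle no vec_syntax

text \<open>
  The variable $q$ is \<^const>\<open>fps_X\<close>, and infinite sums and products of power series are taken in
  the $q$-adic metric that the library puts on \<^typ>\<open>'a fps\<close>. The coefficients lie in an arbitrary
  field: $a$ complex is the instance \<^typ>\<open>complex\<close>, and $a$ an indeterminate is the
  instance of the rational functions over the complex numbers, with $a$ the variable.
\<close>

definition q_factor :: "'a::field \<Rightarrow> nat \<Rightarrow> 'a fps" where
  "q_factor a n = 1 + fps_const a * fps_X ^ n + fps_X ^ (2 * n)"

definition increasing_tuples :: "nat \<Rightarrow> nat list set" where
  "increasing_tuples t = {ns. length ns = t \<and> sorted_wrt (<) ns \<and> (\<forall>n\<in>set ns. 1 \<le> n)}"

definition U_summand :: "nat \<Rightarrow> nat \<Rightarrow> 'a::field \<Rightarrow> nat list \<Rightarrow> 'a fps" where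
  "U_summand k r a ns = fps_X ^ (r * sum_list ns) / (\<Prod>n\<leftarrow>ns. q_factor a n ^ k)"

definition U_series :: "nat \<Rightarrow> nat \<Rightarrow> nat \<Rightarrow> 'a::field \<Rightarrow> 'a fps" where
  "U_series t k r a = (\<Sum>\<^sub>\<infinity>ns\<in>increasing_tuples t. U_summand k r a ns)"

text \<open>The library product is indexed from $0$, hence the shift to \<^term>\<open>Suc n\<close>.\<close>

definition P_factor :: "nat \<Rightarrow> nat \<Rightarrow> 'a::field \<Rightarrow> nat \<Rightarrow> 'a fps" where
  "P_factor k r a n = 1 / ((1 - fps_X ^ (n * r)) * q_factor a n ^ k)"

definition P_series :: "nat \<Rightarrow> nat \<Rightarrow> 'a::field \<Rightarrow> 'a fps" where
  "P_series k r a = (\<Prod>n. P_factor k r a (Suc n))"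


text \<open>
  For $r \ge 1$ the sum and the product converge, so neither takes the default value that the
  library assigns to a divergent expression.
\<close>

lemma q_factor_nth_0: "n \<ge> 1 \<Longrightarrow> q_factor a n $ 0 = 1"
  by (simp add: q_factor_def)

lemma prod_q_factor_nth_0:
  "\<forall>n\<in>set ns. 1 \<le> n \<Longrightarrow> (\<Prod>n\<leftarrow>ns. q_factor a n ^ k) $ 0 = 1"
  by (induction ns) (auto simp: q_factor_nth_0 fps_nth_power_0)

lemma U_summand_altdef:
  assumes "ns \<in> increasing_tuples t"
  shows "U_summand k r a ns = fps_X ^ (r * sum_list ns) * inverse (\<Prod>n\<leftarrow>ns. q_factor a n ^ k)"
  using assms unfolding U_summand_def
  by (intro fps_divide_unit) (simp add: increasing_tuples_def prod_q_factor_nth_0)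

lemma finite_increasing_tuples_sum_le: "finite {ns \<in> increasing_tuples t. sum_list ns \<le> m}"
proof (rule finite_subset)
  show "{ns \<in> increasing_tuples t. sum_list ns \<le> m} \<subseteq> {ns. set ns \<subseteq> {..m} \<and> length ns = t}"
    by (auto simp: increasing_tuples_def dest: member_le_sum_list)
qed (simp add: finite_lists_length_eq)

lemma U_summable:
  assumes "r \<ge> 1"
  shows "U_summand k r a summable_on increasing_tuples t"
proof -
  let ?A = "increasing_tuples t" and ?f = "U_summand k r a"
  define G where "G m = {ns \<in> ?A. sum_list ns \<le> m}" for m
  have zero: "?f ns $ m = 0" if "ns \<in> ?A" "ns \<notin> G m" for ns m
  proof -
    have "m < sum_list ns" using that by (simp add: G_def)
    also have "\<dots> \<le> r * sum_list ns" using assms by simp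
    finally show ?thesis using that by (simp add: U_summand_altdef fps_X_power_mult_nth)
  qed
  have "(?f has_sum Abs_fps (\<lambda>m. sum ?f (G m) $ m)) ?A"
    unfolding has_sum_def
  proof (rule tendsto_fpsI)
    fix m
    have "sum ?f F $ m = sum ?f (G m) $ m" if "finite F" "G m \<subseteq> F" "F \<subseteq> ?A" for F
      unfolding fps_sum_nth using that zero by (intro sum.mono_neutral_right) auto
    moreover have "finite (G m)" "G m \<subseteq> ?A"
      by (auto simp: G_def finite_increasing_tuples_sum_le)
    ultimately show "\<forall>\<^sub>F F in finite_subsets_at_top ?A.
        sum ?f F $ m = Abs_fps (\<lambda>m. sum ?f (G m) $ m) $ m"
      unfolding eventually_finite_subsets_at_top fps_nth_Abs_fps by blast
  qed
  then show ?thesis by (auto simp: summable_on_def)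
qed

lemma P_factor_eq_one_plus:
  assumes "r \<ge> 1"
  obtains H where "P_factor k r a (Suc n) = 1 + fps_X ^ Suc n * H"
proof -
  let ?X = "fps_X ^ Suc n :: 'a fps"
  let ?D = "(1 - fps_X ^ (Suc n * r)) * q_factor a (Suc n) ^ k"
  have X: "fps_X ^ (Suc n * r) = ?X * fps_X ^ (Suc n * (r - 1))"
    using assms by (cases r) (simp_all add: power_add algebra_simps)
  have "?X dvd 1 - (1 - fps_X ^ (Suc n * r))"
    unfolding X by simp
  moreover have "?X dvd 1 - q_factor a (Suc n)"
    unfolding q_factor_def mult_2 power_add
    by (rule dvdI[of _ _ "- fps_const a - ?X"]) (simp add: algebra_simps)
  then have "?X dvd 1 - q_factor a (Suc n) ^ k"
  proof (induction k)
    case (Suc k)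
    have "1 - q_factor a (Suc n) ^ Suc k =
        (1 - q_factor a (Suc n)) + q_factor a (Suc n) * (1 - q_factor a (Suc n) ^ k)"
      by (simp add: algebra_simps)
    with Suc show ?case by (metis dvd_add dvd_mult)
  qed simp
  moreover have "1 - ?D = (1 - (1 - fps_X ^ (Suc n * r))) +
      (1 - fps_X ^ (Suc n * r)) * (1 - q_factor a (Suc n) ^ k)"
    by (simp add: algebra_simps)
  ultimately have "?X dvd 1 - ?D" by (metis dvd_add dvd_mult)
  then obtain E where E: "1 - ?D = ?X * E" by (elim dvdE)
  have D0: "?D $ 0 \<noteq> 0"
    using assms by (simp add: q_factor_nth_0 fps_nth_power_0 power_0_left)
  have "P_factor k r a (Suc n) = inverse ?D"
    unfolding P_factor_def by (subst fps_divide_unit[OF D0]) simp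
  also have "\<dots> = (?D + (1 - ?D)) * inverse ?D" by simp
  also have "\<dots> = ?D * inverse ?D + (1 - ?D) * inverse ?D"
    by (rule distrib_right)
  also have "\<dots> = 1 + ?X * (E * inverse ?D)"
    unfolding inverse_mult_eq_1'[OF D0] E by (simp only: mult.assoc)
  finally show ?thesis by (rule that)
qed

lemma P_convergent:
  assumes "r \<ge> 1"
  shows "convergent_prod (\<lambda>n. P_factor k r a (Suc n))"
proof -
  let ?f = "\<lambda>n. P_factor k r a (Suc n)"
  define S where "S n = (\<Prod>i\<le>n. ?f i)" for n
  have step: "S (Suc n) $ m = S n $ m" if "m \<le> n" for m n
  proof -
    obtain H where "?f (Suc n) = 1 + fps_X ^ Suc (Suc n) * H"
      using P_factor_eq_one_plus[OF assms] by blast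
    then have "S (Suc n) = S n + fps_X ^ Suc (Suc n) * (S n * H)"
      by (simp add: S_def algebra_simps)
    then show ?thesis using that by (simp add: fps_X_power_mult_nth del: power_Suc)
  qed
  have stable: "S n $ m = S m $ m" if "m \<le> n" for m n
    using that by (induction n rule: dec_induct) (simp_all add: step)
  have lim: "S \<longlonglongrightarrow> Abs_fps (\<lambda>m. S m $ m)"
  proof (rule tendsto_fpsI)
    fix m
    show "\<forall>\<^sub>F n in sequentially. S n $ m = Abs_fps (\<lambda>m. S m $ m) $ m"
      using eventually_ge_at_top[of m] by eventually_elim (auto intro: stable)
  qed
  obtain H where "?f 0 = 1 + fps_X ^ Suc 0 * H"
    using P_factor_eq_one_plus[OF assms] by blast
  then have "S 0 $ 0 = 1" by (simp add: S_def)
  then have "Abs_fps (\<lambda>m. S m $ m) \<noteq> 0" by (metis fps_nth_Abs_fps fps_zero_nth zero_neq_one)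
  with lim have "raw_has_prod ?f 0 (Abs_fps (\<lambda>m. S m $ m))"
    unfolding raw_has_prod_def S_def by simp
  then show ?thesis by (auto simp: convergent_prod_def)
qed

end

theory Submission
  imports Defs
begin

text \<open>
  The smallest tuple \<open>(1, \<dots>, t)\<close> has weight \<open>q\<close> to the power \<open>r t (t + 1) / 2\<close>; dividing by this
  power leaves a sum in which a tuple of excess \<open>m\<close>, that is, of sum \<open>t (t + 1) / 2 + m\<close>, has weight
  \<open>q\<close> to the power \<open>r m\<close>. The entries of a tuple that differ from their minimal values occupy a
  final segment of positions, and each contributes at least 1 to the excess. Hence if position \<open>i\<close>
  (counted from 1) is displaced, then \<open>m \<ge> t + 1 - i\<close>. Moving the denominator of that position from
  \<open>n\<^sub>i\<close> back to \<open>i\<close> changes it only from \<open>q\<close> to the power \<open>i\<close> on, and together with the weight this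
  is a change of order at least \<open>i + r m \<ge> t + 1\<close>. So modulo \<open>q\<close> to the power \<open>t + 1\<close> every
  tuple may be given the denominators of the smallest one, and these factor out of the sum
  (\<open>q_factors_mult_U_series_cong\<close>).

  What remains is the generating function of the sums of increasing tuples, the case \<open>k = 0\<close> of the
  same series. Lowering all entries by 1 and splitting according to whether the first entry becomes
  0 gives a recursion in \<open>t\<close> (\<open>U_series_zero_rec\<close>), whose solution is the smallest weight times the
  product of \<open>1 / (1 - q\<^sup>i\<^sup>r)\<close> over \<open>i \<le> t\<close> (\<open>U_series_zero_closed_form\<close>). Without the
  smallest weight, and divided by the denominators of the smallest tuple, this is the product of the
  first \<open>t\<close> factors of the right-hand side; the later factors are congruent to 1 modulo \<open>q\<close> to the
  power \<open>t + 1\<close> (\<open>P_series_cong_partial_product\<close>).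
\<close>

section \<open>Power series congruences and their limits\<close>

lemma fps_X_power_dvd_iff:
  "fps_X ^ N dvd (f :: 'a::field fps) \<longleftrightarrow> (\<forall>m<N. f $ m = 0)"
proof
  assume "fps_X ^ N dvd f"
  then show "\<forall>m<N. f $ m = 0" by (auto simp: fps_X_power_mult_nth elim!: dvdE)
next
  assume "\<forall>m<N. f $ m = 0"
  then have "f = fps_X ^ N * fps_shift N f"
    by (intro fps_ext) (simp add: fps_X_power_mult_nth)
  then show "fps_X ^ N dvd f" by (rule dvdI)
qed

text \<open>
  Convergence in the \<open>q\<close>-adic metric means that every coefficient is eventually constant, and a
  coefficient of a sum or a product depends on finitely many coefficients of the arguments. The
  resulting continuity makes the general calculus of \<^const>\<open>has_sum\<close> and \<^const>\<open>prodinf\<close>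
  applicable to power series.
\<close>

instance fps :: (ab_group_add) topological_comm_monoid_add
proof
  fix a b :: "'a fps"
  have "((\<lambda>x. fst x + snd x) \<longlongrightarrow> a + b) (nhds a \<times>\<^sub>F nhds b)"
  proof (rule tendsto_fpsI)
    fix n
    have "\<forall>\<^sub>F x in nhds c. x $ n = c $ n" for c :: "'a fps"
      using tendsto_fps_iff[of "\<lambda>x. x" c "nhds c"] by (simp add: filterlim_ident)
    from eventually_prodI[OF this this]
    show "\<forall>\<^sub>F x in nhds a \<times>\<^sub>F nhds b. (fst x + snd x) $ n = (a + b) $ n"
      by eventually_elim simp
  qed
  then show "LIM x nhds a \<times>\<^sub>F nhds b. fst x + snd x :> nhds (a + b)" .
qed

instance fps :: (ring) topological_semigroup_mult
proof
  fix a b :: "'a fps"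
  have "((\<lambda>x. fst x * snd x) \<longlongrightarrow> a * b) (nhds a \<times>\<^sub>F nhds b)"
  proof (rule tendsto_fpsI)
    fix n
    have "\<forall>\<^sub>F x in nhds c. x $ i = c $ i" for c :: "'a fps" and i
      using tendsto_fps_iff[of "\<lambda>x. x" c "nhds c"] by (simp add: filterlim_ident)
    then have "\<forall>\<^sub>F x in nhds c. \<forall>i\<in>{..n}. x $ i = c $ i" for c :: "'a fps"
      by (intro eventually_ball_finite) auto
    from eventually_prodI[OF this this]
    show "\<forall>\<^sub>F x in nhds a \<times>\<^sub>F nhds b. (fst x * snd x) $ n = (a * b) $ n"
      by eventually_elim (auto simp: fps_mult_nth intro!: sum.cong)
  qed
  then show "LIM x nhds a \<times>\<^sub>F nhds b. fst x * snd x :> nhds (a * b)" .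
qed

text \<open>
  Multiples of a fixed power of \<open>q\<close> form a closed set, so congruences modulo that power may be
  checked on finite partial sums and products.
\<close>

lemma fps_X_power_dvd_limit:
  fixes f :: "'b \<Rightarrow> 'a::field fps"
  assumes "(f \<longlongrightarrow> L) F" "F \<noteq> bot" "\<forall>\<^sub>F x in F. fps_X ^ N dvd f x"
  shows "fps_X ^ N dvd L"
  unfolding fps_X_power_dvd_iff
proof (intro allI impI)
  fix m assume "m < N"
  have "\<forall>\<^sub>F x in F. f x $ m = L $ m" using assms(1) by (simp add: tendsto_fps_iff)
  with assms(3) have "\<forall>\<^sub>F x in F. L $ m = 0"
    by eventually_elim (use \<open>m < N\<close> in \<open>auto simp: fps_X_power_dvd_iff\<close>)
  with assms(2) show "L $ m = 0" by simp
qed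

lemma fps_X_power_dvd_has_sum:
  fixes f :: "'b \<Rightarrow> 'a::field fps"
  assumes "(f has_sum S) A" "\<And>x. x \<in> A \<Longrightarrow> fps_X ^ N dvd f x"
  shows "fps_X ^ N dvd S"
proof (rule fps_X_power_dvd_limit)
  show "(sum f \<longlongrightarrow> S) (finite_subsets_at_top A)" using assms(1) by (simp add: has_sum_def)
  show "\<forall>\<^sub>F B in finite_subsets_at_top A. fps_X ^ N dvd sum f B"
    using assms(2) by (intro eventually_finite_subsets_at_top_weakI dvd_sum) auto
qed simp

section \<open>Replacing the denominators by those of the smallest tuple\<close>

lemma dvd_prod_diff:
  fixes d :: "'a::comm_ring_1"
  assumes "\<And>i. i \<in> A \<Longrightarrow> d dvd f i - g i"
  shows "d dvd prod f A - prod g A"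
  using assms
proof (induction A rule: infinite_finite_induct)
  case (insert x A)
  have "prod f (insert x A) - prod g (insert x A) =
      (f x - g x) * prod f A + g x * (prod f A - prod g A)"
    using insert.hyps by (simp add: algebra_simps)
  then show ?case using insert by (simp add: dvd_add dvd_mult dvd_mult2)
qed auto

lemma dvd_one_minus_power:
  fixes d :: "'a::comm_ring_1"
  assumes "d dvd 1 - x"
  shows "d dvd 1 - x ^ k"
  using dvd_prod_diff[of "{..<k}" d "\<lambda>_. 1" "\<lambda>_. x"] assms by simp

lemma fps_X_power_dvd_one_minus_q_factor:
  assumes "d \<le> n"
  shows "fps_X ^ d dvd 1 - q_factor a n ^ k"
proof (rule dvd_one_minus_power)
  have "fps_X ^ n dvd 1 - q_factor a n"
    unfolding q_factor_def mult_2 power_add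
    by (rule dvdI[of _ _ "- fps_const a - fps_X ^ n"]) (simp add: algebra_simps)
  with assms show "fps_X ^ d dvd 1 - q_factor a n"
    by (meson dvd_trans le_imp_power_dvd)
qed

lemma increasing_tuples_gap:
  assumes "ns \<in> increasing_tuples t" "i \<le> j" "j < t"
  shows "ns ! i + (j - i) \<le> ns ! j"
  using assms(2,3)
proof (induction j rule: dec_induct)
  case (step j)
  have "ns ! j < ns ! Suc j"
    using assms(1) step.prems by (auto simp: increasing_tuples_def sorted_wrt_nth_less)
  with step show ?case by simp
qed simp

lemma increasing_tuples_nth_ge:
  assumes "ns \<in> increasing_tuples t" "i < t"
  shows "Suc i \<le> ns ! i"
proof -
  have "ns ! 0 \<in> set ns" using assms by (auto simp: increasing_tuples_def)
  with assms(1) have "1 \<le> ns ! 0" by (auto simp: increasing_tuples_def)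
  with increasing_tuples_gap[OF assms(1), of 0 i] assms(2) show ?thesis by simp
qed

lemma increasing_tuples_sum_list:
  "ns \<in> increasing_tuples t \<Longrightarrow> sum_list ns = (\<Sum>i<t. ns ! i)"
  by (simp add: increasing_tuples_def sum.list_conv_set_nth atLeast0LessThan)

lemma increasing_tuples_sum_ge:
  assumes "ns \<in> increasing_tuples t"
  shows "(\<Sum>i<t. Suc i) \<le> sum_list ns"
  unfolding increasing_tuples_sum_list[OF assms]
  by (intro sum_mono) (simp add: increasing_tuples_nth_ge[OF assms] del: sum.lessThan_Suc)

text \<open>
  Once an entry exceeds its minimal value, so does every later one; each of the \<open>t - j\<close> positions
  from \<open>j\<close> on then adds at least 1 to the sum. Positions are counted from 0 here.
\<close>

lemma increasing_tuples_sum_excess: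
  assumes "ns \<in> increasing_tuples t" "j < t" "ns ! j \<noteq> Suc j"
  shows "(\<Sum>i<t. Suc i) + (t - j) \<le> sum_list ns"
proof -
  have "(\<Sum>i<t. Suc i) + (t - j) = (\<Sum>i<t. Suc i + (if j \<le> i then 1 else 0))"
  proof -
    have "{..<t} \<inter> {i. j \<le> i} = {j..<t}" by auto
    then show ?thesis by (simp add: sum.distrib sum.If_cases del: add_Suc)
  qed
  also have "\<dots> \<le> (\<Sum>i<t. ns ! i)"
  proof (rule sum_mono)
    fix i assume "i \<in> {..<t}"
    then show "Suc i + (if j \<le> i then 1 else 0) \<le> ns ! i"
      using increasing_tuples_nth_ge[OF assms(1), of i] increasing_tuples_nth_ge[OF assms(1,2)]
        increasing_tuples_gap[OF assms(1), of j i] assms(3) by auto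
  qed
  finally show ?thesis by (simp add: increasing_tuples_sum_list[OF assms(1)])
qed

text \<open>
  The trade-off at the heart of the theorem: a displaced entry at a late position changes its
  denominator only at a high order, and one at an early position forces a large weight. The
  congruence is multiplied out so that no inverse of the common product of denominators occurs.
\<close>

lemma q_factors_mult_U_summand_cong:
  fixes a :: "'a::field"
  assumes ns: "ns \<in> increasing_tuples t" and "r \<ge> 1"
  shows "fps_X ^ (r * (\<Sum>i<t. Suc i) + Suc t) dvd
    (\<Prod>i<t. q_factor a (Suc i) ^ k) * U_summand k r a ns - U_summand 0 r a ns"
proof -
  define s where "s = (\<Sum>i<t. Suc i)"
  define Q where "Q = (\<Prod>i<t. q_factor a (Suc i) ^ k)"
  define R where "R = (\<Prod>i<t. q_factor a (ns ! i) ^ k)"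
  \<comment> \<open>The order to which the denominators have to agree once the weight of the tuple is accounted for.
    It is 0, as a truncated difference, for tuples whose weight alone reaches the claimed order.\<close>
  define d where "d = Suc t - (r * sum_list ns - r * s)"
  have R: "(\<Prod>n\<leftarrow>ns. q_factor a n ^ k) = R"
    using ns by (simp add: R_def increasing_tuples_def prod.list_conv_set_nth atLeast0LessThan)
  have R0: "R $ 0 = 1"
    using prod_q_factor_nth_0[of ns a k] ns unfolding R by (simp add: increasing_tuples_def)
  have s: "s \<le> sum_list ns" unfolding s_def by (rule increasing_tuples_sum_ge[OF ns])
  have "fps_X ^ d dvd Q - R"
    unfolding Q_def R_def
  proof (rule dvd_prod_diff)
    fix i assume "i \<in> {..<t}"
    then have i: "i < t" by simp
    show "fps_X ^ d dvd q_factor a (Suc i) ^ k - q_factor a (ns ! i) ^ k"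
    proof (cases "ns ! i = Suc i")
      case False
      have "t - i \<le> sum_list ns - s"
        using increasing_tuples_sum_excess[OF ns i False] by (simp add: s_def)
      also have "\<dots> \<le> r * (sum_list ns - s)" using \<open>r \<ge> 1\<close> by simp
      also have "\<dots> = r * sum_list ns - r * s" by (rule diff_mult_distrib2)
      finally have d: "d \<le> Suc i" by (simp add: d_def)
      with increasing_tuples_nth_ge[OF ns i] have "d \<le> ns ! i" by simp
      with d have "fps_X ^ d dvd (1 - q_factor a (ns ! i) ^ k) - (1 - q_factor a (Suc i) ^ k)"
        by (intro dvd_diff fps_X_power_dvd_one_minus_q_factor)
      then show ?thesis by simp
    qed simp
  qed
  then have "fps_X ^ (r * sum_list ns + d) dvd fps_X ^ (r * sum_list ns) * (Q - R) * inverse R"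
    by (simp add: power_add mult_dvd_mono)
  moreover have "fps_X ^ (r * s + Suc t) dvd (fps_X ^ (r * sum_list ns + d) :: 'a fps)"
    using s by (intro le_imp_power_dvd) (simp add: d_def)
  ultimately have "fps_X ^ (r * s + Suc t) dvd fps_X ^ (r * sum_list ns) * (Q - R) * inverse R"
    using dvd_trans by blast
  moreover have "Q * U_summand k r a ns - U_summand 0 r a ns =
      fps_X ^ (r * sum_list ns) * (Q - R) * inverse R"
  proof -
    have "U_summand 0 r a ns = fps_X ^ (r * sum_list ns) * (R * inverse R)"
      using R0 by (simp add: U_summand_altdef[OF ns] inverse_mult_eq_1' map_replicate_const)
    then show ?thesis by (simp add: U_summand_altdef[OF ns] R algebra_simps)
  qed
  ultimately show ?thesis by (simp only: Q_def s_def)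
qed

lemma U_series_has_sum:
  "r \<ge> 1 \<Longrightarrow> (U_summand k r a has_sum U_series t k r a) (increasing_tuples t)"
  unfolding U_series_def by (simp add: U_summable)

lemma q_factors_mult_U_series_cong:
  assumes "r \<ge> 1"
  shows "fps_X ^ (r * (\<Sum>i<t. Suc i) + Suc t) dvd
    (\<Prod>i<t. q_factor a (Suc i) ^ k) * U_series t k r a - U_series t 0 r a"
proof (rule fps_X_power_dvd_has_sum)
  let ?Q = "\<Prod>i<t. q_factor a (Suc i) ^ k"
  \<comment> \<open>The difference is written with a factor \<open>- 1\<close> to fit the rules for sums and scalar multiples.\<close>
  have "((\<lambda>ns. ?Q * U_summand k r a ns + (- 1) * U_summand 0 r a ns) has_sum
      (?Q * U_series t k r a + (- 1) * U_series t 0 r a)) (increasing_tuples t)"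
    using assms by (intro has_sum_add has_sum_cmult_right U_series_has_sum)
  then show "((\<lambda>ns. ?Q * U_summand k r a ns - U_summand 0 r a ns) has_sum
      (?Q * U_series t k r a - U_series t 0 r a)) (increasing_tuples t)" by simp
qed (rule q_factors_mult_U_summand_cong[OF _ assms])

section \<open>The generating function of increasing tuples\<close>

text \<open>
  Lowering every entry by 1 leaves an increasing tuple whose first entry is 0 or positive. In the
  first case the remaining entries are an arbitrary shorter tuple.
\<close>

lemma increasing_tuples_Suc:
  "increasing_tuples (Suc t) = map Suc ` (Cons 0 ` increasing_tuples t \<union> increasing_tuples (Suc t))"
proof (intro equalityI subsetI)
  fix ns assume ns: "ns \<in> increasing_tuples (Suc t)"
  define ms where "ms = map (\<lambda>n. n - 1) ns"
  have "map Suc ms = ns"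
    using ns by (auto simp: ms_def increasing_tuples_def intro!: map_idI)
  moreover have "sorted_wrt (<) ms"
    unfolding ms_def sorted_wrt_map
  proof (rule sorted_wrt_mono_rel)
    show "sorted_wrt (<) ns" using ns by (simp add: increasing_tuples_def)
    show "x - 1 < y - 1" if "x \<in> set ns" "y \<in> set ns" "x < y" for x y
      using ns that by (auto simp: increasing_tuples_def intro: diff_less_mono)
  qed
  moreover have "length ms = Suc t" using ns by (simp add: ms_def increasing_tuples_def)
  ultimately have "map Suc ms = ns" "ms \<in> Cons 0 ` increasing_tuples t \<union> increasing_tuples (Suc t)"
    by (cases ms; force simp: increasing_tuples_def image_iff Suc_le_eq intro: gr_zeroI)+
  then show "ns \<in> map Suc ` (Cons 0 ` increasing_tuples t \<union> increasing_tuples (Suc t))"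
    by blast
qed (auto simp: increasing_tuples_def sorted_wrt_map Suc_le_eq)

lemma U_summand_exponent_zero: "U_summand 0 r a ns = fps_X ^ (r * sum_list ns)"
  by (simp add: U_summand_def map_replicate_const)

text \<open>
  Raising all \<open>t + 1\<close> entries by 1 multiplies the weight by \<open>q\<close> to the power \<open>r (t + 1)\<close>, while
  prefixing a 0 does not change it. Thus, for \<open>c\<close> this power of \<open>q\<close> and \<open>F\<^sub>t\<close> the
  generating function, \<open>F\<^sub>t\<^sub>+\<^sub>1 = c (F\<^sub>t + F\<^sub>t\<^sub>+\<^sub>1)\<close>.
\<close>

lemma U_series_zero_rec:
  assumes "r \<ge> 1"
  shows "(1 - fps_X ^ (r * Suc t)) * U_series (Suc t) 0 r a =
    fps_X ^ (r * Suc t) * U_series t 0 r a"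
proof -
  let ?f = "U_summand 0 r a" and ?S = "Cons 0 ` increasing_tuples t" and ?T = "increasing_tuples (Suc t)"
  let ?c = "fps_X ^ (r * Suc t) :: 'a fps"
  have inj: "inj_on (map Suc) A" for A by (rule inj_on_subset[OF inj_mapI]) simp_all
  have "?f \<circ> Cons 0 = ?f" by (simp add: fun_eq_iff U_summand_exponent_zero)
  then have "(?f has_sum U_series t 0 r a) ?S"
    using U_series_has_sum[OF assms, of 0 a t] by (simp add: has_sum_reindex)
  moreover have "?S \<inter> ?T = {}" by (auto simp: increasing_tuples_def)
  ultimately have "(?f has_sum (U_series t 0 r a + U_series (Suc t) 0 r a)) (?S \<union> ?T)"
    using U_series_has_sum[OF assms] by (intro has_sum_Un_disjoint)
  then have "((\<lambda>ns. ?c * ?f ns) has_sum ?c * (U_series t 0 r a + U_series (Suc t) 0 r a)) (?S \<union> ?T)"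
    by (rule has_sum_cmult_right)
  also have "?this \<longleftrightarrow> 
     ((?f \<circ> map Suc) has_sum ?c * (U_series t 0 r a + U_series (Suc t) 0 r a)) (?S \<union> ?T)"
  proof (rule has_sum_cong)
    fix ns assume "ns \<in> ?S \<union> ?T"
    then have "length ns = Suc t" by (auto simp: increasing_tuples_def)
    then have "sum_list (map Suc ns) = Suc t + sum_list ns"
      using sum_list_addf[of "\<lambda>_. 1" "\<lambda>n. n" ns] by (simp add: sum_list_triv)
    then show "?c * ?f ns = (?f \<circ> map Suc) ns"
      by (simp only: U_summand_exponent_zero o_apply add_mult_distrib2 power_add)
  qed
  also have "\<dots> \<longleftrightarrow> (?f has_sum ?c * (U_series t 0 r a + U_series (Suc t) 0 r a)) ?T"
    by (simp only: increasing_tuples_Suc[of t, symmetric] flip: has_sum_reindex[OF inj])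
  finally have "U_series (Suc t) 0 r a = ?c * (U_series t 0 r a + U_series (Suc t) 0 r a)"
    using U_series_has_sum[OF assms] has_sum_unique by blast
  then show ?thesis by (simp add: algebra_simps)
qed

lemma U_series_zero_closed_form:
  assumes "r \<ge> 1"
  shows "(\<Prod>i<t. 1 - fps_X ^ (r * Suc i)) * U_series t 0 r a = fps_X ^ (r * (\<Sum>i<t. Suc i))"
proof (induction t)
  case 0
  have "increasing_tuples 0 = {[]}" by (auto simp: increasing_tuples_def)
  then show ?case by (simp add: U_series_def U_summand_exponent_zero)
next
  case (Suc t)
  have "(\<Prod>i<Suc t. 1 - fps_X ^ (r * Suc i)) * U_series (Suc t) 0 r a =
      (\<Prod>i<t. 1 - fps_X ^ (r * Suc i)) * ((1 - fps_X ^ (r * Suc t)) * U_series (Suc t) 0 r a)"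
    by (simp only: prod.lessThan_Suc mult.assoc)
  also have "\<dots> = fps_X ^ (r * Suc t) * ((\<Prod>i<t. 1 - fps_X ^ (r * Suc i)) * U_series t 0 r a)"
    by (simp only: U_series_zero_rec[OF assms] mult.left_commute)
  also have "\<dots> = fps_X ^ (r * (\<Sum>i<Suc t. Suc i))"
    by (simp only: Suc.IH sum.lessThan_Suc add_mult_distrib2 power_add
        mult.commute[of "fps_X ^ (r * Suc t)"])
  finally show ?case .
qed

section \<open>Truncating the infinite product\<close>

lemma P_series_LIMSEQ:
  assumes "r \<ge> 1"
  shows "(\<lambda>n. \<Prod>i\<le>n. P_factor k r a (Suc i)) \<longlonglongrightarrow> P_series k r a"
proof -
  have "P_factor k r a (Suc i) \<noteq> 0" for i
  proof -
    obtain H where "P_factor k r a (Suc i) = 1 + fps_X ^ Suc i * H"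
      using P_factor_eq_one_plus[OF assms] by blast
    then have "P_factor k r a (Suc i) $ 0 = 1" by simp
    then show ?thesis by auto
  qed
  then obtain L where "(\<lambda>n. \<Prod>i\<le>n. P_factor k r a (Suc i)) \<longlonglongrightarrow> L" "L \<noteq> 0"
    using P_convergent[OF assms, of k a] by (auto simp: convergent_prod_iff_nz_lim)
  then show ?thesis unfolding P_series_def by (simp add: prodinf_eq_prod_lim)
qed

lemma P_series_cong_partial_product:
  assumes "r \<ge> 1"
  shows "fps_X ^ Suc t dvd P_series k r a - (\<Prod>i<t. P_factor k r a (Suc i))"
proof (rule fps_X_power_dvd_limit)
  let ?f = "\<lambda>i. P_factor k r a (Suc i)"
  show "(\<lambda>n. (\<Prod>i\<le>n. ?f i) + - (\<Prod>i<t. ?f i)) \<longlonglongrightarrow> P_series k r a - (\<Prod>i<t. ?f i)"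
    unfolding diff_conv_add_uminus by (intro tendsto_intros P_series_LIMSEQ assms)
  show "\<forall>\<^sub>F n in sequentially. fps_X ^ Suc t dvd (\<Prod>i\<le>n. ?f i) + - (\<Prod>i<t. ?f i)"
    using eventually_ge_at_top[of t]
  proof eventually_elim
    case (elim n)
    have "(\<Prod>i<t. ?f i) = (\<Prod>i\<le>n. if i < t then ?f i else 1)"
      using elim by (intro prod.mono_neutral_cong_left) auto
    \<comment> \<open>Padded with ones, the short product can be compared with the long one factor by factor.\<close>
    moreover have "fps_X ^ Suc t dvd (\<Prod>i\<le>n. ?f i) - (\<Prod>i\<le>n. if i < t then ?f i else 1)"
    proof (rule dvd_prod_diff)
      fix i
      obtain H where "?f i = 1 + fps_X ^ Suc i * H"
        using P_factor_eq_one_plus[OF assms] by blast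
      moreover have "fps_X ^ Suc t dvd (fps_X ^ Suc i :: 'a fps)" if "\<not> i < t"
        using that by (intro le_imp_power_dvd) simp
      ultimately show "fps_X ^ Suc t dvd ?f i - (if i < t then ?f i else 1)"
        by (simp add: dvd_mult2 del: power_Suc)
    qed
    ultimately show ?case by simp
  qed
qed simp

section \<open>The limit formula\<close>

theorem theorem1p4:
  fixes t k r :: nat and a :: "'a::field"
  assumes "t \<ge> 1" and "k \<ge> 1" and "r \<ge> 1"
  shows "\<exists>E :: 'a fps. fps_X ^ (t + 1) dvd E \<and>
    fls_X powi (- int (r * t * (t + 1) div 2)) * fps_to_fls (U_series t k r a) =
      fps_to_fls (P_series k r a + E)"
proof -
  define T where "T = r * (\<Sum>i<t. Suc i)"
  define Q where "Q = (\<Prod>i<t. q_factor a (Suc i) ^ k)"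
  define D where "D = (\<Prod>i<t. 1 - fps_X ^ (r * Suc i) :: 'a fps)"
  define P where "P = (\<Prod>i<t. P_factor k r a (Suc i))"
  have T: "r * t * (t + 1) div 2 = T"
  proof -
    have "2 * (\<Sum>i<t. Suc i) = t * (t + 1)" by (induction t) auto
    then have "r * t * (t + 1) = 2 * T" by (metis T_def mult.assoc mult.left_commute)
    then show ?thesis by simp
  qed
  have PDQ: "P * (D * Q) = 1"
  proof -
    have "P_factor k r a (Suc i) * ((1 - fps_X ^ (r * Suc i)) * q_factor a (Suc i) ^ k) = 1" for i
    proof -
      let ?d = "(1 - fps_X ^ (r * Suc i)) * q_factor a (Suc i) ^ k"
      have d0: "?d $ 0 \<noteq> 0"
        using assms(3) by (simp add: q_factor_nth_0 fps_nth_power_0 power_0_left)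
      have "P_factor k r a (Suc i) = inverse ?d"
        unfolding P_factor_def by (subst mult.commute[of "Suc i"], subst fps_divide_unit[OF d0]) simp
      then show ?thesis using inverse_mult_eq_1[OF d0] by simp
    qed
    then show ?thesis unfolding P_def D_def Q_def prod.distrib[symmetric] by simp
  qed
  obtain G where G: "Q * U_series t k r a - U_series t 0 r a = fps_X ^ (T + Suc t) * G"
    using q_factors_mult_U_series_cong[OF assms(3), of t a k] unfolding T_def Q_def dvd_def by blast
  obtain H where H: "P_series k r a - P = fps_X ^ Suc t * H"
    using P_series_cong_partial_product[OF assms(3), of t k a] unfolding P_def dvd_def by blast
  \<comment> \<open>With \<open>P = 1 / (D Q)\<close>, solving the two congruences for the series gives this remainder.\<close>
  define E where "E = fps_X ^ Suc t * (P * D * G - H)"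
  have "U_series t k r a = P * (D * Q) * U_series t k r a" by (simp add: PDQ)
  also have "\<dots> = P * (D * U_series t 0 r a + D * (Q * U_series t k r a - U_series t 0 r a))"
    by (simp add: algebra_simps)
  also have "\<dots> = fps_X ^ T * (P + fps_X ^ Suc t * (P * D * G))"
    using U_series_zero_closed_form[OF assms(3), of t a]
    unfolding G D_def[symmetric] T_def[symmetric] by (simp add: power_add algebra_simps)
  also have "P + fps_X ^ Suc t * (P * D * G) = P_series k r a + E"
    using H by (simp add: E_def algebra_simps)
  finally have U: "U_series t k r a = fps_X ^ T * (P_series k r a + E)" .
  have "fls_X powi (- int T) * (fls_X ^ T * F) = F" for F :: "'a fls"
    by (simp add: power_int_minus del: fls_X_power_int flip: mult.assoc)
  then have "fls_X powi (- int T) * fps_to_fls (U_series t k r a) = fps_to_fls (P_series k r a + E)"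
    unfolding U fls_times_fps_to_fls fps_to_fls_power fps_X_to_fls .
  moreover have "fps_X ^ (t + 1) dvd E" by (simp add: E_def)
  ultimately show ?thesis unfolding T by blast
qed

end
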